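(* Let $U$ and $V$ be abelian groups. If $S\subseteq\mathrm{End}(U)\times\mathrm{End}(V)^{\mathrm{op}}$ and $\circ\colon U\times V\to W$ is a (full) bimap, then $$\otimes_S\to\circ\quad\text{if, and only if,}\quad S\subseteq\mathrm{Adj}(\circ).$$ This establishes a Galois connection between the lattice of factor-equivalence classes of bimaps on $U\times V$ and the lattice of subsets of $\mathrm{End}(U)\times\mathrm{End}(V)^{\mathrm{op}}$. Moreover, (i) $\mathrm{Adj}(\otimes_{\mathrm{Adj}(\circ)})=\mathrm{Adj}(\circ)$, and (ii) $\otimes_{\mathrm{Adj}(\otimes_S)}\leftrightarrow\otimes_S$. Hence $\mathrm{Adj}(\otimes_{-})$ (that is, $S\mapsto\mathrm{Adj}(\otimes_S)$) and $\otimes_{\mathrm{Adj}(-)}$ (that is, $\circ\mapsto\otimes_{\mathrm{Adj}(\circ)}$) are closure operators on the two lattices.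
   Context: A bimap $\circ\colon U\times V\to W$ is a biadditive map of abelian groups; all bimaps are assumed full, i.e. $W=U\circ V=\langle u\circ v:u\in U,v\in V\rangle$. For bimaps $\circ\colon U\times V\to X$ and $\diamond\colon U\times V\to Y$ write $\circ\to\diamond$ ("$\diamond$ factors through $\circ$") if there is a homomorphism $\tau\colon X\to Y$ with $(u\circ v)^\tau=u\diamond v$ for all $u\in U,v\in V$; write $\circ\leftrightarrow\diamond$ (factor equivalent) if $\circ\to\diamond$ and $\diamond\to\circ$. The relation $\to$ is a partial order on factor-equivalence classes of bimaps on $U\times V$, and these classes form a lattice under $\to$. The subsets of $\mathrm{End}(U)\times\mathrm{End}(V)^{\mathrm{op}}$ form a lattice under $\subseteq$. Endomorphisms of $U$ are written on the right; $\mathrm{End}(V)^{\mathrm{op}}$ consists of the additive endomorphisms of $V$ written on the left, with $(yy')v=y(y'v)$. For $s=(x,y)\in\mathrm{End}(U)\times\mathrm{End}(V)^{\mathrm{op}}$ put $us=ux$ and $sv=yv$. $U\otimes_SV$ is the quotient of the tensor product $U\otimes V$ of abelian groups by the subgroup generated by all $us\otimes v-u\otimes sv$ ($s\in S$, $u\in U$, $v\in V$), and $\otimes_S\colon U\times V\to U\otimes_SV$ is the associated bimap. $\mathrm{Adj}(\circ)=\{(x,y)\in\mathrm{End}(U)\times\mathrm{End}(V)^{\mathrm{op}}:ux\circ v=u\circ yv\ \forall u\in U,v\in V\}$. A Galois connection between partially ordered sets $(P,\leq)$ and $(Q,\subseteq)$ is a pair of functions $\bot\colon P\to Q$, $\top\colon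 Q\to P$ such that for all $p\in P,q\in Q$: $q^\top\leq p\iff q\subseteq p^\bot$; here $P$ is the set of factor-equivalence classes with $\leq$ being $\to$, $Q$ is the set of subsets, $q^{\top}=\otimes_q$ and $p^{\bot}=\mathrm{Adj}(p)$.
   Formalization: The map ∘ ↦ ⊗_{Adj(∘)} is proved to be a closure operator for the reverse of the order →: one always has ⊗_{Adj(∘)} → ∘, while ∘ → ⊗_{Adj(∘)} fails in general, so for → itself it is not extensive. *)

theory Defs
  imports "HOL-Algebra.Galois_Connection" "HOL-Algebra.Free_Abelian_Groups"
    "HOL-Algebra.Weak_Morphisms"
begin

section \<open>Bimaps\<close>

text \<open>
  Abelian groups are HOL-Algebra groups, hence written multiplicatively.  A bimap on
  \<open>U \<times> V\<close> is a pair of a codomain \<open>W\<close> and a map \<open>f\<close>; the values of \<open>f\<close> outside the carriers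
  of \<open>U\<close> and \<open>V\<close> are irrelevant.
\<close>

type_synonym ('u, 'v, 'w) bimap = "'w monoid \<times> ('u \<Rightarrow> 'v \<Rightarrow> 'w)"

definition biadditive :: "'u monoid \<Rightarrow> 'v monoid \<Rightarrow> ('u, 'v, 'w) bimap \<Rightarrow> bool" where
  "biadditive U V b \<longleftrightarrow>
     (\<forall>v\<in>carrier V. (\<lambda>u. snd b u v) \<in> hom U (fst b)) \<and>
     (\<forall>u\<in>carrier U. (\<lambda>v. snd b u v) \<in> hom V (fst b))"

definition full_bimap :: "'u monoid \<Rightarrow> 'v monoid \<Rightarrow> ('u, 'v, 'w) bimap \<Rightarrow> bool" where
  "full_bimap U V b \<longleftrightarrow> comm_group (fst b) \<and> biadditive U V b \<and>
     carrier (fst b) = generate (fst b) {snd b u v |u v. u \<in> carrier U \<and> v \<in> carrier V}"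

text \<open>\<open>factors U V b c\<close> is \<open>b \<rightarrow> c\<close>: the bimap \<open>c\<close> factors through \<open>b\<close>.\<close>

definition factors ::
    "'u monoid \<Rightarrow> 'v monoid \<Rightarrow> ('u, 'v, 'x) bimap \<Rightarrow> ('u, 'v, 'y) bimap \<Rightarrow> bool" where
  "factors U V b c \<longleftrightarrow>
     (\<exists>\<tau>\<in>hom (fst b) (fst c). \<forall>u\<in>carrier U. \<forall>v\<in>carrier V. \<tau> (snd b u v) = snd c u v)"

definition factor_equiv ::
    "'u monoid \<Rightarrow> 'v monoid \<Rightarrow> ('u, 'v, 'x) bimap \<Rightarrow> ('u, 'v, 'y) bimap \<Rightarrow> bool" where
  "factor_equiv U V b c \<longleftrightarrow> factors U V b c \<and> factors U V c b"


section \<open>Adjoints and tensor products\<close>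

text \<open>
  Endomorphisms are taken extensional, so that equality of endomorphisms is equality of
  functions.  The opposite multiplication on \<open>End(V)\<close> does not change the underlying set,
  and only subsets of \<open>End(U) \<times> End(V)\<^sup>o\<^sup>p\<close> matter here; \<open>x u\<close> stands for \<open>ux\<close>, and \<open>y v\<close> for \<open>yv\<close>.
\<close>

definition Endo :: "'a monoid \<Rightarrow> ('a \<Rightarrow> 'a) set" where
  "Endo G = hom G G \<inter> extensional (carrier G)"

definition Adj ::
    "'u monoid \<Rightarrow> 'v monoid \<Rightarrow> ('u, 'v, 'w) bimap \<Rightarrow> (('u \<Rightarrow> 'u) \<times> ('v \<Rightarrow> 'v)) set" where
  "Adj U V b = {(x, y) \<in> Endo U \<times> Endo V.
     \<forall>u\<in>carrier U. \<forall>v\<in>carrier V. snd b (x u) v = snd b u (y v)}"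

text \<open>
  \<open>U \<otimes> V\<close> is the free abelian group on the set \<open>U \<times> V\<close> (finitely supported integer-valued
  functions, written additively) modulo the bilinearity relations.
\<close>

definition bilinearity_relations :: "'u monoid \<Rightarrow> 'v monoid \<Rightarrow> ('u \<times> 'v \<Rightarrow>\<^sub>0 int) set" where
  "bilinearity_relations U V =
     {frag_of (u \<otimes>\<^bsub>U\<^esub> u', v) - frag_of (u, v) - frag_of (u', v) |u u' v.
        u \<in> carrier U \<and> u' \<in> carrier U \<and> v \<in> carrier V} \<union>
     {frag_of (u, v \<otimes>\<^bsub>V\<^esub> v') - frag_of (u, v) - frag_of (u, v') |u v v'.
        u \<in> carrier U \<and> v \<in> carrier V \<and> v' \<in> carrier V}"

definition bilinearity_subgroup :: "'u monoid \<Rightarrow> 'v monoid \<Rightarrow> ('u \<times> 'v \<Rightarrow>\<^sub>0 int) set" where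
  "bilinearity_subgroup U V =
     generate (free_Abelian_group (carrier U \<times> carrier V)) (bilinearity_relations U V)"

definition tensor_product ::
    "'u monoid \<Rightarrow> 'v monoid \<Rightarrow> ('u \<times> 'v \<Rightarrow>\<^sub>0 int) set monoid" where
  "tensor_product U V =
     free_Abelian_group (carrier U \<times> carrier V) Mod bilinearity_subgroup U V"

definition pure_tensor ::
    "'u monoid \<Rightarrow> 'v monoid \<Rightarrow> 'u \<Rightarrow> 'v \<Rightarrow> ('u \<times> 'v \<Rightarrow>\<^sub>0 int) set" where
  "pure_tensor U V u v =
     bilinearity_subgroup U V #>\<^bsub>free_Abelian_group (carrier U \<times> carrier V)\<^esub> frag_of (u, v)"

definition balancing_subgroup ::
    "'u monoid \<Rightarrow> 'v monoid \<Rightarrow> (('u \<Rightarrow> 'u) \<times> ('v \<Rightarrow> 'v)) set \<Rightarrow> ('u \<times> 'v \<Rightarrow>\<^sub>0 int) set set" where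
  "balancing_subgroup U V S = generate (tensor_product U V)
     {pure_tensor U V (x u) v \<otimes>\<^bsub>tensor_product U V\<^esub>
        inv\<^bsub>tensor_product U V\<^esub> pure_tensor U V u (y v) |x y u v.
        (x, y) \<in> S \<and> u \<in> carrier U \<and> v \<in> carrier V}"

type_synonym ('u, 'v) tensor_bimap = "('u, 'v, ('u \<times> 'v \<Rightarrow>\<^sub>0 int) set set) bimap"

definition tensor_over ::
    "'u monoid \<Rightarrow> 'v monoid \<Rightarrow> (('u \<Rightarrow> 'u) \<times> ('v \<Rightarrow> 'v)) set \<Rightarrow> ('u, 'v) tensor_bimap" where
  "tensor_over U V S =
     (tensor_product U V Mod balancing_subgroup U V S,
      \<lambda>u v. balancing_subgroup U V S #>\<^bsub>tensor_product U V\<^esub> pure_tensor U V u v)"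


section \<open>The two lattices\<close>

text \<open>
  Bimaps on \<open>U \<times> V\<close> with arbitrary codomains do not form a set in HOL.  The codomains are
  therefore taken in the type that contains all the groups \<open>U \<otimes>\<^sub>S V\<close>; lemma
  \<open>full_bimap_representable\<close> below shows that no factor-equivalence class is lost.
\<close>

definition factor_rel :: "'u monoid \<Rightarrow> 'v monoid \<Rightarrow> ('u, 'v) tensor_bimap rel" where
  "factor_rel U V =
     {(b, c). full_bimap U V b \<and> full_bimap U V c \<and> factor_equiv U V b c}"

definition bimap_lattice :: "'u monoid \<Rightarrow> 'v monoid \<Rightarrow> ('u, 'v) tensor_bimap set gorder" where
  "bimap_lattice U V =
     \<lparr>carrier = {b. full_bimap U V b} // factor_rel U V,
      eq = (=),
      le = (\<lambda>B C. \<exists>b\<in>B. \<exists>c\<in>C. factors U V b c)\<rparr>"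

definition subset_lattice ::
    "'u monoid \<Rightarrow> 'v monoid \<Rightarrow> (('u \<Rightarrow> 'u) \<times> ('v \<Rightarrow> 'v)) set gorder" where
  "subset_lattice U V = \<lparr>carrier = Pow (Endo U \<times> Endo V), eq = (=), le = (\<subseteq>)\<rparr>"

definition tensor_class ::
    "'u monoid \<Rightarrow> 'v monoid \<Rightarrow> (('u \<Rightarrow> 'u) \<times> ('v \<Rightarrow> 'v)) set \<Rightarrow> ('u, 'v) tensor_bimap set" where
  "tensor_class U V S = factor_rel U V `` {tensor_over U V S}"

text \<open>All members of a class have the same adjoints, see lemma \<open>Adj_class_eq\<close> below.\<close>

definition Adj_class ::
    "'u monoid \<Rightarrow> 'v monoid \<Rightarrow> ('u, 'v) tensor_bimap set \<Rightarrow> (('u \<Rightarrow> 'u) \<times> ('v \<Rightarrow> 'v)) set" where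
  "Adj_class U V B = (\<Inter>b\<in>B. Adj U V b)"

definition adjoint_tensor_connection ::
    "'u monoid \<Rightarrow> 'v monoid \<Rightarrow>
      ((('u \<Rightarrow> 'u) \<times> ('v \<Rightarrow> 'v)) set, ('u, 'v) tensor_bimap set) galois" where
  "adjoint_tensor_connection U V =
     \<lparr>orderA = subset_lattice U V, orderB = bimap_lattice U V,
      lower = tensor_class U V, upper = Adj_class U V\<rparr>"

text \<open>
  A closure operator is extensive.  Since \<open>\<otimes>\<^bsub>Adj(\<circ>)\<^esub> \<rightarrow> \<circ>\<close> always holds and the converse fails in
  general, \<open>\<circ> \<mapsto> \<otimes>\<^bsub>Adj(\<circ>)\<^esub>\<close> is a closure operator only for the dual of the order \<open>\<rightarrow>\<close>.
\<close>

definition closure_operator :: "'a gorder \<Rightarrow> ('a \<Rightarrow> 'a) \<Rightarrow> bool" where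
  "closure_operator L f \<longleftrightarrow>
     f \<in> carrier L \<rightarrow> carrier L \<and>
     (\<forall>x\<in>carrier L. x \<sqsubseteq>\<^bsub>L\<^esub> f x) \<and> isotone L L f \<and> idempotent L f"


section \<open>Adequacy of the encoding\<close>

lemma factors_refl: "factors U V b b"
  unfolding factors_def by (rule bexI[of _ "\<lambda>w. w"]) (auto simp: hom_def)

lemma factors_trans:
  assumes "factors U V b c" "factors U V c d"
  shows "factors U V b d"
proof -
  obtain \<sigma> \<tau> where "\<sigma> \<in> hom (fst b) (fst c)" "\<tau> \<in> hom (fst c) (fst d)"
    and "\<forall>u\<in>carrier U. \<forall>v\<in>carrier V. \<sigma> (snd b u v) = snd c u v"
    and "\<forall>u\<in>carrier U. \<forall>v\<in>carrier V. \<tau> (snd c u v) = snd d u v"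
    using assms unfolding factors_def by blast
  then show ?thesis
    unfolding factors_def by (intro bexI[of _ "\<tau> \<circ> \<sigma>"]) (auto intro: Group.hom_compose)
qed

lemma equiv_factor_rel: "equiv {b. full_bimap U V b} (factor_rel U V)"
proof (rule equivI)
  show "trans (factor_rel U V)"
    unfolding factor_rel_def factor_equiv_def by (rule transI) (blast dest: factors_trans)
qed (auto simp: factor_rel_def factor_equiv_def refl_on_def sym_def factors_refl)

lemma le_bimap_lattice_iff:
  assumes "B \<in> carrier (bimap_lattice U V)" "C \<in> carrier (bimap_lattice U V)" "b \<in> B" "c \<in> C"
  shows "B \<sqsubseteq>\<^bsub>bimap_lattice U V\<^esub> C \<longleftrightarrow> factors U V b c"
proof -
  have "factor_equiv U V b b'" if "b' \<in> B" for b'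
    using quotient_eq_iff[OF equiv_factor_rel, of B U V B b b'] assms that
    by (auto simp: bimap_lattice_def factor_rel_def)
  moreover have "factor_equiv U V c c'" if "c' \<in> C" for c'
    using quotient_eq_iff[OF equiv_factor_rel, of C U V C c c'] assms that
    by (auto simp: bimap_lattice_def factor_rel_def)
  ultimately show ?thesis
    using assms(3,4) unfolding bimap_lattice_def factor_equiv_def gorder.simps
    by (meson factors_trans)
qed

lemma factors_Adj_mono:
  assumes "factors U V b c"
  shows "Adj U V b \<subseteq> Adj U V c"
proof -
  obtain \<tau> where \<tau>: "\<forall>u\<in>carrier U. \<forall>v\<in>carrier V. \<tau> (snd b u v) = snd c u v"
    using assms unfolding factors_def by blast
  show ?thesis
  proof (clarsimp simp: Adj_def)
    fix x y u v
    assume xy: "x \<in> Endo U" "y \<in> Endo V" and uv: "u \<in> carrier U" "v \<in> carrier V"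
      and "\<forall>u\<in>carrier U. \<forall>v\<in>carrier V. snd b (x u) v = snd b u (y v)"
    then have "\<tau> (snd b (x u) v) = \<tau> (snd b u (y v))" by simp
    moreover have "x u \<in> carrier U" "y v \<in> carrier V"
      using xy uv by (auto simp: Endo_def hom_def)
    ultimately show "snd c (x u) v = snd c u (y v)" using \<tau> uv by metis
  qed
qed

lemma Adj_class_eq:
  assumes "B \<in> carrier (bimap_lattice U V)" "b \<in> B"
  shows "Adj_class U V B = Adj U V b"
proof -
  have "Adj U V b' = Adj U V b" if "b' \<in> B" for b'
    using quotient_eq_iff[OF equiv_factor_rel, of B U V B b b'] assms that
    by (auto simp: bimap_lattice_def factor_rel_def factor_equiv_def dest: factors_Adj_mono)
  then show ?thesis
    using assms(2) unfolding Adj_class_def by blast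
qed

lemma full_bimap_representable:
  fixes b :: "('u, 'v, 'w) bimap"
  assumes "full_bimap U V b"
  shows "\<exists>c :: ('u, 'v) tensor_bimap. full_bimap U V c \<and> factor_equiv U V b c"
proof -
  obtain W f where b: "b = (W, f)" by (cases b)
  let ?A = "carrier U \<times> carrier V"
  let ?F = "free_Abelian_group ?A"
  let ?B = "{f u v |u v. u \<in> carrier U \<and> v \<in> carrier V}"
  have W: "comm_group W" and gen_W: "carrier W = generate W ?B"
    and hom_l: "\<And>v. v \<in> carrier V \<Longrightarrow> (\<lambda>u. f u v) \<in> hom U W"
    and hom_r: "\<And>u. u \<in> carrier U \<Longrightarrow> f u \<in> hom V W"
    using assms by (simp_all add: b full_bimap_def biadditive_def)
  interpret W: comm_group W by (rule W)
  have fW: "f u v \<in> carrier W" if "u \<in> carrier U" "v \<in> carrier V" for u v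
    using that hom_in_carrier[OF hom_r] by blast
  have BW: "?B \<subseteq> carrier W" using fW by blast
  obtain h where h: "h \<in> hom ?F W" "\<And>p. p \<in> ?A \<Longrightarrow> h (frag_of p) = (case p of (u, v) \<Rightarrow> f u v)"
    by (rule W.free_Abelian_group_universal[of "\<lambda>(u, v). f u v" ?A]) (use fW in auto)
  interpret h: group_hom ?F W h
    using h(1) by (auto simp: group_hom_def group_hom_axioms_def)
  have "{f u v |u v. u \<in> carrier U \<and> v \<in> carrier V} \<subseteq> h ` carrier ?F"
  proof clarify
    fix u v assume "u \<in> carrier U" "v \<in> carrier V"
    then show "f u v \<in> h ` carrier ?F"
      using h(2)[of "(u, v)"] by (intro image_eqI[of _ _ "frag_of (u, v)"]) auto
  qed
  then have surj: "carrier W \<subseteq> h ` carrier ?F"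
    using W.generate_subgroup_incl[OF _ h.img_is_subgroup] gen_W by blast
  define g where "g w = {{c \<in> carrier ?F. h c = w}}" for w
  have inj: "inj_on g (carrier W)"
  proof (rule inj_onI)
    fix w w' assume w: "w \<in> carrier W" "g w = g w'"
    then obtain c where "c \<in> carrier ?F" "h c = w" using surj by blast
    then show "w = w'" using w(2) unfolding g_def by blast
  qed
  let ?X = "image_group g W"
  have iso: "g \<in> iso W ?X" by (rule inj_imp_image_group_iso[OF inj])
  have hom: "g \<in> hom W ?X" using iso by (simp add: iso_def)
  have X: "comm_group ?X"
    using W.iso_imp_img_comm_group[OF iso] by (simp add: image_group_def)
  interpret g: group_hom W ?X g
    using hom X by (auto simp: group_hom_def group_hom_axioms_def comm_group_def)
  have inv: "inv_into (carrier W) g \<in> hom ?X W"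
    using W.iso_set_sym[OF iso] by (simp add: iso_def)
  define c where "c = (?X, \<lambda>u v. g (f u v))"
  have "carrier ?X = g ` carrier W" by (simp only: image_group_carrier)
  also have "\<dots> = g ` generate W ?B" by (subst gen_W) (rule refl)
  also have "\<dots> = generate ?X (g ` ?B)" by (rule g.generate_img[OF BW, symmetric])
  also have "g ` ?B = {g (f u v) |u v. u \<in> carrier U \<and> v \<in> carrier V}" by blast
  finally have gen: "carrier ?X = generate ?X {g (f u v) |u v. u \<in> carrier U \<and> v \<in> carrier V}" .
  have "(\<lambda>u. g (f u v)) \<in> hom U ?X" if "v \<in> carrier V" for v
    using Group.hom_compose[OF hom_l[OF that] hom] by (simp only: comp_def)
  moreover have "(\<lambda>v. g (f u v)) \<in> hom V ?X" if "u \<in> carrier U" for u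
    using Group.hom_compose[OF hom_r[OF that] hom] by (simp only: comp_def)
  ultimately have "full_bimap U V c"
    unfolding c_def full_bimap_def biadditive_def fst_conv snd_conv
    by (intro conjI ballI X gen)
  moreover have "factors U V b c"
    unfolding factors_def b c_def fst_conv snd_conv by (intro bexI[OF _ hom] ballI refl)
  moreover have "factors U V c b"
    unfolding factors_def b c_def fst_conv snd_conv
    by (intro bexI[OF _ inv] ballI inv_into_f_f[OF inj] fW)
  ultimately show ?thesis unfolding factor_equiv_def by blast
qed

end

theory Submission
  imports Defs
begin

text \<open>
  Everything rests on the correspondence between full bimaps on \<open>U \<times> V\<close> and subgroups of the
  tensor product \<open>T = U \<otimes> V\<close>.  A full bimap \<open>b\<close> linearizes to a homomorphism from \<open>T\<close> onto its
  codomain, and the kernel of that homomorphism determines \<open>b\<close> up to factor equivalence: since a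
  homomorphism out of a quotient of \<open>T\<close> is a homomorphism out of \<open>T\<close> that kills the subgroup,
  \<open>b \<rightarrow> c\<close> holds exactly if the kernel of \<open>b\<close> is contained in that of \<open>c\<close>
  (\<open>factors_iff_kernel_subset\<close>).  Every subgroup \<open>K\<close> occurs, as the kernel of \<open>U \<times> V \<rightarrow> T / K\<close>
  (\<open>bimap_kernel_quotient_bimap\<close>).  Hence the factor-equivalence classes are ordered like the
  subgroups of \<open>T\<close>, which form a lattice.

  The bimap \<open>\<otimes>\<^sub>S\<close> corresponds to the subgroup generated by the elements \<open>us \<otimes> v - u \<otimes> sv\<close>.  It lies
  in the kernel of \<open>b\<close> if and only if each of these generators is sent to zero by the linearization
  of \<open>b\<close>, that is, if and only if every \<open>s \<in> S\<close> is an adjoint pair of \<open>b\<close>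
  (\<open>balancing_subset_kernel_iff\<close>).  This is the equivalence of \<open>\<otimes>\<^sub>S \<rightarrow> b\<close> and \<open>S \<subseteq> Adj(b)\<close>.
  The assertions on closures are formal consequences, as for any Galois connection.
\<close>

section \<open>Homomorphisms and quotients of abelian groups\<close>

lemma (in group) mult_inv_eq_one_iff:
  assumes "a \<in> carrier G" "b \<in> carrier G"
  shows "a \<otimes> inv b = \<one> \<longleftrightarrow> a = b"
  using inv_solve_right[of \<one> a b] assms by auto

lemma hom_eqI_generate:
  assumes "group_hom G H f" "group_hom G H g" "A \<subseteq> carrier G"
    and eq: "\<And>a. a \<in> A \<Longrightarrow> f a = g a"
    and "t \<in> generate G A"
  shows "f t = g t"
proof -
  interpret f: group_hom G H f by fact
  interpret g: group_hom G H g by fact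
  note carr = f.G.generate_in_carrier[OF \<open>A \<subseteq> carrier G\<close>]
  show ?thesis
    using \<open>t \<in> generate G A\<close>
  proof induction
    case (inv a)
    then show ?case using \<open>A \<subseteq> carrier G\<close> by (auto simp: eq)
  qed (auto simp: carr eq)
qed

lemma (in comm_group) quotient_group_hom:
  assumes "subgroup N G"
  shows "group_hom G (G Mod N) (\<lambda>a. N #> a)"
proof -
  interpret normal N G using assms by (rule subgroup_imp_normal)
  show ?thesis
    using factorgroup_is_group r_coset_hom_Mod is_group
    by (simp add: group_hom_def group_hom_axioms_def)
qed

lemma (in comm_group) kernel_quotient_hom:
  assumes "subgroup N G"
  shows "kernel G (G Mod N) (\<lambda>a. N #> a) = N"
proof -
  have "N #> a = N \<longleftrightarrow> a \<in> N" if "a \<in> carrier G" for a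
    using assms that coset_join1 coset_join2 subgroup.subset by blast
  then show ?thesis
    using subgroup.subset[OF assms] by (auto simp: kernel_def)
qed

lemma free_Abelian_group_generated:
  "carrier (free_Abelian_group A) = generate (free_Abelian_group A) (frag_of ` A)"
proof
  interpret F: comm_group "free_Abelian_group A" by (rule abelian_free_Abelian_group)
  have gens: "frag_of ` A \<subseteq> carrier (free_Abelian_group A)" by auto
  then show "generate (free_Abelian_group A) (frag_of ` A) \<subseteq> carrier (free_Abelian_group A)"
    by (rule F.generate_incl)
  interpret S: subgroup "generate (free_Abelian_group A) (frag_of ` A)" "free_Abelian_group A"
    using gens by (rule F.generate_is_subgroup)
  show "carrier (free_Abelian_group A) \<subseteq> generate (free_Abelian_group A) (frag_of ` A)"
  proof
    fix c assume "c \<in> carrier (free_Abelian_group A)"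
    then have "Poly_Mapping.keys c \<subseteq> A" by simp
    then show "c \<in> generate (free_Abelian_group A) (frag_of ` A)"
    proof (rule free_Abelian_group_induct)
      show "0 \<in> generate (free_Abelian_group A) (frag_of ` A)"
        using S.one_closed by simp
    next
      fix x y assume "Poly_Mapping.keys y \<subseteq> A"
        and "x \<in> generate (free_Abelian_group A) (frag_of ` A)"
        and "y \<in> generate (free_Abelian_group A) (frag_of ` A)"
      then show "x - y \<in> generate (free_Abelian_group A) (frag_of ` A)"
        using S.m_closed[OF _ S.m_inv_closed] by fastforce
    qed (simp add: generate.incl)
  qed
qed

text \<open>
  Joins and meets in \<open>M\<close> have preimages under \<open>f\<close>, and because \<open>f\<close> reflects the order these
  preimages are joins and meets in \<open>L\<close>.
\<close>

lemma lattice_order_embedding: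
  assumes "partial_order L" "lattice M"
    and surj: "f ` carrier L = carrier M"
    and le: "\<And>x y. x \<in> carrier L \<Longrightarrow> y \<in> carrier L \<Longrightarrow> x \<sqsubseteq>\<^bsub>L\<^esub> y \<longleftrightarrow> f x \<sqsubseteq>\<^bsub>M\<^esub> f y"
  shows "lattice L"
proof -
  interpret L: partial_order L by fact
  interpret M: lattice M by fact
  have fM: "f x \<in> carrier M" if "x \<in> carrier L" for x
    using that surj by blast
  show ?thesis
  proof
    fix x y assume xy: "x \<in> carrier L" "y \<in> carrier L"
    have "f x \<squnion>\<^bsub>M\<^esub> f y \<in> f ` carrier L" "f x \<sqinter>\<^bsub>M\<^esub> f y \<in> f ` carrier L"
      using xy by (simp_all add: surj fM)
    then obtain s i where s: "s \<in> carrier L" "f s = f x \<squnion>\<^bsub>M\<^esub> f y"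
      and i: "i \<in> carrier L" "f i = f x \<sqinter>\<^bsub>M\<^esub> f y"
      by (metis imageE)
    have "least L s (Upper L {x, y})"
      using xy s by (intro least_UpperI) (auto simp: le fM M.join_left M.join_right Upper_def M.join_le)
    then show "\<exists>s. least L s (Upper L {x, y})" ..
    have "greatest L i (Lower L {x, y})"
      using xy i by (intro greatest_LowerI) (auto simp: le fM M.meet_left M.meet_right Lower_def M.meet_le)
    then show "\<exists>i. greatest L i (Lower L {x, y})" ..
  qed
qed

section \<open>The tensor product\<close>

lemma full_bimapD:
  assumes "full_bimap U V b"
  shows "comm_group (fst b)" "biadditive U V b"
    "carrier (fst b) = generate (fst b) {snd b u v |u v. u \<in> carrier U \<and> v \<in> carrier V}"
  using assms by (simp_all add: full_bimap_def)

lemma biadditive_closed: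
  assumes "biadditive U V b" "u \<in> carrier U" "v \<in> carrier V"
  shows "snd b u v \<in> carrier (fst b)"
  using assms by (auto simp: biadditive_def hom_def)

lemma biadditive_mult:
  assumes "biadditive U V b" "u \<in> carrier U" "v \<in> carrier V"
  shows "u' \<in> carrier U \<Longrightarrow> snd b (u \<otimes>\<^bsub>U\<^esub> u') v = snd b u v \<otimes>\<^bsub>fst b\<^esub> snd b u' v"
    "v' \<in> carrier V \<Longrightarrow> snd b u (v \<otimes>\<^bsub>V\<^esub> v') = snd b u v \<otimes>\<^bsub>fst b\<^esub> snd b u v'"
  using assms by (auto simp: biadditive_def hom_def)

text \<open>
  A surjective homomorphism carries generators to generators.  In this way every quotient of
  \<open>U \<otimes> V\<close>, in particular \<open>U \<otimes>\<^sub>S V\<close>, inherits fullness from the tensor product.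
\<close>

lemma full_bimap_quotient:
  assumes b: "full_bimap U V b" and Q: "comm_group Q" and q: "q \<in> hom (fst b) Q"
    and surj: "q ` carrier (fst b) = carrier Q"
  shows "full_bimap U V (Q, \<lambda>u v. q (snd b u v))"
proof -
  note bD = full_bimapD[OF b]
  interpret q: group_hom "fst b" Q q
    using bD(1) Q q by (simp add: group_hom_def group_hom_axioms_def comm_group_def)
  let ?P = "{snd b u v |u v. u \<in> carrier U \<and> v \<in> carrier V}"
  have "?P \<subseteq> carrier (fst b)" using biadditive_closed[OF bD(2)] by blast
  then have "carrier Q = generate Q (q ` ?P)"
    using q.generate_img surj bD(3) by simp
  also have "q ` ?P = {q (snd b u v) |u v. u \<in> carrier U \<and> v \<in> carrier V}" by blast
  finally have "carrier Q = generate Q \<dots>" .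
  moreover have "biadditive U V (Q, \<lambda>u v. q (snd b u v))"
    unfolding biadditive_def fst_conv snd_conv
    by (intro conjI ballI Group.hom_compose[OF _ q, unfolded comp_def])
      (use bD(2) in \<open>simp_all add: biadditive_def\<close>)
  ultimately show ?thesis
    using Q unfolding full_bimap_def by simp
qed

locale abelian_pair =
  fixes U :: "'u monoid" and V :: "'v monoid"
  assumes U: "comm_group U" and V: "comm_group V"
begin

sublocale U: comm_group U by (rule U)
sublocale V: comm_group V by (rule V)

abbreviation F :: "('u \<times> 'v \<Rightarrow>\<^sub>0 int) monoid"
  where "F \<equiv> free_Abelian_group (carrier U \<times> carrier V)"

abbreviation T :: "('u \<times> 'v \<Rightarrow>\<^sub>0 int) set monoid"
  where "T \<equiv> tensor_product U V"

abbreviation pure_tensors :: "('u \<times> 'v \<Rightarrow>\<^sub>0 int) set set"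
  where "pure_tensors \<equiv> {pure_tensor U V u v |u v. u \<in> carrier U \<and> v \<in> carrier V}"

sublocale F: comm_group F by (rule abelian_free_Abelian_group)

lemma bilinearity_relations_subset: "bilinearity_relations U V \<subseteq> carrier F"
proof -
  have diff: "a - b \<in> carrier F" if "a \<in> carrier F" "b \<in> carrier F" for a b
    using F.m_closed[OF that(1) F.inv_closed[OF that(2)]] that(2) by simp
  show ?thesis
    unfolding bilinearity_relations_def
    by (auto simp del: carrier_free_Abelian_group_iff intro!: diff)
qed

lemma subgroup_bilinearity: "subgroup (bilinearity_subgroup U V) F"
  unfolding bilinearity_subgroup_def
  by (rule F.generate_is_subgroup[OF bilinearity_relations_subset])

sublocale T: comm_group T
  unfolding tensor_product_def by (rule F.abelian_FactGroup[OF subgroup_bilinearity])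

lemma quotient_bilinearity: "group_hom F T (\<lambda>a. bilinearity_subgroup U V #>\<^bsub>F\<^esub> a)"
  unfolding tensor_product_def by (rule F.quotient_group_hom[OF subgroup_bilinearity])

sublocale q: group_hom F T "\<lambda>a. bilinearity_subgroup U V #>\<^bsub>F\<^esub> a"
  by (rule quotient_bilinearity)

text \<open>
  The two kinds of bilinearity relations both have the shape \<open>a - b - c\<close>, so this one computation
  yields additivity of \<open>u \<otimes> v\<close> in either argument.
\<close>

lemma quotient_bilinearity_diff:
  assumes "a - b - c \<in> bilinearity_relations U V"
    and a: "a \<in> carrier F" and b: "b \<in> carrier F" and c: "c \<in> carrier F"
  shows "bilinearity_subgroup U V #>\<^bsub>F\<^esub> a =
    (bilinearity_subgroup U V #>\<^bsub>F\<^esub> b) \<otimes>\<^bsub>T\<^esub> (bilinearity_subgroup U V #>\<^bsub>F\<^esub> c)"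
proof -
  let ?q = "\<lambda>a. bilinearity_subgroup U V #>\<^bsub>F\<^esub> a"
  have r: "a - b - c \<in> bilinearity_subgroup U V"
    using assms(1) by (simp add: bilinearity_subgroup_def generate.incl)
  then have rF: "a - b - c \<in> carrier F"
    using subgroup.subset[OF subgroup_bilinearity] by blast
  have "?q (a - b - c) = \<one>\<^bsub>T\<^esub>"
    using r F.kernel_quotient_hom[OF subgroup_bilinearity]
    unfolding kernel_def tensor_product_def by blast
  moreover have "?q a = ?q ((a - b - c) \<otimes>\<^bsub>F\<^esub> (b \<otimes>\<^bsub>F\<^esub> c))" by simp
  moreover have "\<dots> = ?q (a - b - c) \<otimes>\<^bsub>T\<^esub> (?q b \<otimes>\<^bsub>T\<^esub> ?q c)"
    using q.hom_mult[OF rF F.m_closed[OF b c]] q.hom_mult[OF b c] by (simp only:)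
  ultimately show ?thesis
    using q.hom_closed[OF b] q.hom_closed[OF c] by simp
qed

lemma pure_tensor_closed:
  "u \<in> carrier U \<Longrightarrow> v \<in> carrier V \<Longrightarrow> pure_tensor U V u v \<in> carrier T"
  unfolding pure_tensor_def by (rule q.hom_closed) simp

lemma full_bimap_tensor: "full_bimap U V (T, pure_tensor U V)"
proof -
  have "biadditive U V (T, pure_tensor U V)"
    unfolding biadditive_def fst_conv snd_conv
  proof (intro conjI ballI homI)
    fix v u u' assume "v \<in> carrier V" "u \<in> carrier U" "u' \<in> carrier U"
    then show "pure_tensor U V (u \<otimes>\<^bsub>U\<^esub> u') v = pure_tensor U V u v \<otimes>\<^bsub>T\<^esub> pure_tensor U V u' v"
      unfolding pure_tensor_def
      by (intro quotient_bilinearity_diff) (auto simp: bilinearity_relations_def)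
  next
    fix u v v' assume "u \<in> carrier U" "v \<in> carrier V" "v' \<in> carrier V"
    then show "pure_tensor U V u (v \<otimes>\<^bsub>V\<^esub> v') = pure_tensor U V u v \<otimes>\<^bsub>T\<^esub> pure_tensor U V u v'"
      unfolding pure_tensor_def
      by (intro quotient_bilinearity_diff) (auto simp: bilinearity_relations_def)
  qed (auto intro: pure_tensor_closed)
  moreover have "carrier T = generate T pure_tensors"
  proof -
    have "carrier T = (\<lambda>a. bilinearity_subgroup U V #>\<^bsub>F\<^esub> a) ` carrier F"
      by (simp add: tensor_product_def carrier_FactGroup)
    also have "\<dots> = generate T ((\<lambda>a. bilinearity_subgroup U V #>\<^bsub>F\<^esub> a) ` frag_of ` (carrier U \<times> carrier V))"
      by (subst free_Abelian_group_generated) (rule q.generate_img[symmetric], auto)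
    also have "(\<lambda>a. bilinearity_subgroup U V #>\<^bsub>F\<^esub> a) ` frag_of ` (carrier U \<times> carrier V) = pure_tensors"
      by (auto simp: pure_tensor_def)
    finally show ?thesis .
  qed
  ultimately show ?thesis
    by (simp add: full_bimap_def T.comm_group_axioms)
qed

lemma carrier_tensor: "carrier T = generate T pure_tensors"
  using full_bimapD(3)[OF full_bimap_tensor] by simp

text \<open>
  The map \<open>(u, v) \<mapsto> b(u, v)\<close> extends to the free abelian group on \<open>U \<times> V\<close>; biadditivity of \<open>b\<close> says
  precisely that the extension kills the bilinearity relations, so it descends to \<open>U \<otimes> V\<close>.
\<close>

lemma tensor_universal:
  assumes "comm_group (fst b)" and b: "biadditive U V b"
  obtains h where "h \<in> hom T (fst b)"
    "\<And>u v. u \<in> carrier U \<Longrightarrow> v \<in> carrier V \<Longrightarrow> h (pure_tensor U V u v) = snd b u v"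
proof -
  interpret W: comm_group "fst b" by fact
  obtain g where g: "g \<in> hom F (fst b)"
    and g_frag: "\<And>p. p \<in> carrier U \<times> carrier V \<Longrightarrow> g (frag_of p) = case_prod (snd b) p"
    by (rule W.free_Abelian_group_universal[of "case_prod (snd b)" "carrier U \<times> carrier V"])
      (use biadditive_closed[OF b] in auto)
  interpret g: group_hom F "fst b" g
    using g by (simp add: group_hom_def group_hom_axioms_def W.is_group)
  have g_diff: "a - c - d \<in> kernel F (fst b) g"
    if "g a = g c \<otimes>\<^bsub>fst b\<^esub> g d" "a \<in> carrier F" "c \<in> carrier F" "d \<in> carrier F" for a c d
  proof -
    have *: "a - c - d = a \<otimes>\<^bsub>F\<^esub> inv\<^bsub>F\<^esub> (c \<otimes>\<^bsub>F\<^esub> d)"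
      using F.m_closed[OF that(3,4)] by simp
    have "g (a \<otimes>\<^bsub>F\<^esub> inv\<^bsub>F\<^esub> (c \<otimes>\<^bsub>F\<^esub> d)) = g a \<otimes>\<^bsub>fst b\<^esub> inv\<^bsub>fst b\<^esub> (g c \<otimes>\<^bsub>fst b\<^esub> g d)"
      using that(2-4) by (simp only: g.hom_mult g.hom_inv F.m_closed F.inv_closed)
    also have "\<dots> = \<one>\<^bsub>fst b\<^esub>"
      using that(1) g.hom_closed[OF that(2)] by (simp add: W.mult_inv_eq_one_iff)
    finally show ?thesis
      unfolding kernel_def * using that(2-4)
      by (simp del: mult_free_Abelian_group carrier_free_Abelian_group_iff inv_free_Abelian_group)
  qed
  have "bilinearity_relations U V \<subseteq> kernel F (fst b) g"
    unfolding bilinearity_relations_def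
    by (auto intro!: g_diff simp: g_frag biadditive_mult[OF b])
  then have "bilinearity_subgroup U V \<subseteq> kernel F (fst b) g"
    unfolding bilinearity_subgroup_def
    by (rule F.generate_subgroup_incl[OF _ g.subgroup_kernel])
  then obtain h where "h \<in> hom T (fst b)"
    and "\<And>a. a \<in> carrier F \<Longrightarrow> h (bilinearity_subgroup U V #>\<^bsub>F\<^esub> a) = g a"
    using g.FactGroup_universal_kernel[OF F.subgroup_imp_normal[OF subgroup_bilinearity]]
    unfolding tensor_product_def by blast
  then show thesis
    by (intro that[of h]) (simp_all add: pure_tensor_def g_frag)
qed

section \<open>Bimaps and subgroups of the tensor product\<close>

text \<open>
  Pure tensors generate \<open>U \<otimes> V\<close>, so for a full bimap the choice is determined on the carrier of
  \<open>U \<otimes> V\<close> (lemma \<open>linearization_unique\<close>), and the kernel below does not depend on it.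
\<close>

definition linearization :: "('u, 'v, 'w) bimap \<Rightarrow> ('u \<times> 'v \<Rightarrow>\<^sub>0 int) set \<Rightarrow> 'w" where
  "linearization b = (SOME h. h \<in> hom T (fst b) \<and>
     (\<forall>u\<in>carrier U. \<forall>v\<in>carrier V. h (pure_tensor U V u v) = snd b u v))"

definition bimap_kernel :: "('u, 'v, 'w) bimap \<Rightarrow> ('u \<times> 'v \<Rightarrow>\<^sub>0 int) set set" where
  "bimap_kernel b = kernel T (fst b) (linearization b)"

lemma linearization:
  assumes "full_bimap U V b"
  shows "group_hom T (fst b) (linearization b)"
    "\<And>u v. u \<in> carrier U \<Longrightarrow> v \<in> carrier V \<Longrightarrow> linearization b (pure_tensor U V u v) = snd b u v"
proof -
  note b = full_bimapD[OF assms]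
  have "\<exists>h. h \<in> hom T (fst b) \<and>
     (\<forall>u\<in>carrier U. \<forall>v\<in>carrier V. h (pure_tensor U V u v) = snd b u v)"
    using tensor_universal[OF b(1,2)] by metis
  from someI_ex[OF this, folded linearization_def]
  show "group_hom T (fst b) (linearization b)"
    "\<And>u v. u \<in> carrier U \<Longrightarrow> v \<in> carrier V \<Longrightarrow> linearization b (pure_tensor U V u v) = snd b u v"
    using b(1) by (simp_all add: group_hom_def group_hom_axioms_def comm_group_def T.is_group)
qed

lemma linearization_unique:
  assumes b: "full_bimap U V b" and h: "group_hom T (fst b) h"
    and "\<And>u v. u \<in> carrier U \<Longrightarrow> v \<in> carrier V \<Longrightarrow> h (pure_tensor U V u v) = snd b u v"
    and t: "t \<in> carrier T"
  shows "h t = linearization b t"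
  by (rule hom_eqI_generate[OF h linearization(1)[OF b], where A = pure_tensors])
    (use assms(3) linearization(2)[OF b] t carrier_tensor pure_tensor_closed in auto)

text \<open>
  This is where fullness enters: the image is a subgroup that contains all the values of the
  bimap, and these generate the codomain.
\<close>

lemma linearization_surj:
  assumes "full_bimap U V b"
  shows "linearization b ` carrier T = carrier (fst b)"
proof
  interpret h: group_hom T "fst b" "linearization b" by (rule linearization(1)[OF assms])
  show "linearization b ` carrier T \<subseteq> carrier (fst b)" by auto
  have "{snd b u v |u v. u \<in> carrier U \<and> v \<in> carrier V} \<subseteq> linearization b ` carrier T"
  proof clarify
    fix u v assume "u \<in> carrier U" "v \<in> carrier V"
    then show "snd b u v \<in> linearization b ` carrier T"
      using linearization(2)[OF assms] pure_tensor_closed by (metis image_eqI)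
  qed
  then show "carrier (fst b) \<subseteq> linearization b ` carrier T"
    unfolding full_bimapD(3)[OF assms]
    by (rule h.H.generate_subgroup_incl[OF _ h.img_is_subgroup])
qed

lemma subgroup_bimap_kernel: "full_bimap U V b \<Longrightarrow> subgroup (bimap_kernel b) T"
  unfolding bimap_kernel_def by (rule group_hom.subgroup_kernel[OF linearization(1)])

text \<open>
  If \<open>\<tau>\<close> witnesses \<open>b \<rightarrow> c\<close>, then \<open>\<tau>\<close> after the linearization of \<open>b\<close> agrees with the linearization
  of \<open>c\<close> on pure tensors, hence everywhere, and the kernels are nested.  Conversely, the
  linearization of \<open>b\<close> is onto; sending \<open>w\<close> to the image under the linearization of \<open>c\<close> of any
  preimage of \<open>w\<close> is well defined once the kernels are nested.
\<close>

lemma factors_iff_kernel_subset: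
  assumes b: "full_bimap U V b" and c: "full_bimap U V c"
  shows "factors U V b c \<longleftrightarrow> bimap_kernel b \<subseteq> bimap_kernel c"
proof -
  interpret b: group_hom T "fst b" "linearization b" by (rule linearization(1)[OF b])
  interpret c: group_hom T "fst c" "linearization c" by (rule linearization(1)[OF c])
  show ?thesis
  proof
    assume "factors U V b c"
    then obtain \<tau> where \<tau>: "\<tau> \<in> hom (fst b) (fst c)"
      and \<tau>_snd: "\<And>u v. u \<in> carrier U \<Longrightarrow> v \<in> carrier V \<Longrightarrow> \<tau> (snd b u v) = snd c u v"
      unfolding factors_def by blast
    interpret \<tau>: group_hom "fst b" "fst c" \<tau>
      using \<tau> by (simp add: group_hom_def group_hom_axioms_def b.H.is_group c.H.is_group)
    have "group_hom T (fst c) (\<tau> \<circ> linearization b)"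
      using Group.hom_compose[OF b.homh \<tau>]
      by (simp add: group_hom_def group_hom_axioms_def T.is_group c.H.is_group)
    then have "linearization c t = \<tau> (linearization b t)" if "t \<in> carrier T" for t
      using linearization_unique[OF c _ _ that] linearization(2)[OF b] \<tau>_snd by fastforce
    then show "bimap_kernel b \<subseteq> bimap_kernel c"
      unfolding bimap_kernel_def kernel_def by auto
  next
    assume sub: "bimap_kernel b \<subseteq> bimap_kernel c"
    have eq: "linearization c t = linearization c t'"
      if "t \<in> carrier T" "t' \<in> carrier T" "linearization b t = linearization b t'" for t t'
    proof -
      have "t \<otimes>\<^bsub>T\<^esub> inv\<^bsub>T\<^esub> t' \<in> bimap_kernel b"
        using that by (simp add: bimap_kernel_def kernel_def)
      then have "linearization c (t \<otimes>\<^bsub>T\<^esub> inv\<^bsub>T\<^esub> t') = \<one>\<^bsub>fst c\<^esub>"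
        using sub by (auto simp: bimap_kernel_def kernel_def)
      then show ?thesis
        using that by (simp add: c.H.mult_inv_eq_one_iff)
    qed
    \<comment> \<open>by \<open>eq\<close>, the value does not depend on the preimage that \<open>inv_into\<close> selects\<close>
    define \<tau> where "\<tau> w = linearization c (inv_into (carrier T) (linearization b) w)" for w
    have \<tau>: "\<tau> (linearization b t) = linearization c t" if "t \<in> carrier T" for t
      unfolding \<tau>_def using that
      by (intro eq) (simp_all add: inv_into_into f_inv_into_f)
    have "\<tau> \<in> hom (fst b) (fst c)"
    proof (rule homI)
      fix w w' assume "w \<in> carrier (fst b)" "w' \<in> carrier (fst b)"
      then obtain t t' where "t \<in> carrier T" "t' \<in> carrier T"
        "w = linearization b t" "w' = linearization b t'"
        using linearization_surj[OF b] by blast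
      then show "\<tau> (w \<otimes>\<^bsub>fst b\<^esub> w') = \<tau> w \<otimes>\<^bsub>fst c\<^esub> \<tau> w'"
        by (simp add: \<tau> flip: b.hom_mult)
    next
      fix w assume "w \<in> carrier (fst b)"
      then obtain t where "t \<in> carrier T" "w = linearization b t"
        using linearization_surj[OF b] by blast
      then show "\<tau> w \<in> carrier (fst c)" by (simp add: \<tau>)
    qed
    moreover have "\<tau> (snd b u v) = snd c u v" if "u \<in> carrier U" "v \<in> carrier V" for u v
      using \<tau>[OF pure_tensor_closed[OF that]] that linearization(2)[OF b] linearization(2)[OF c]
      by simp
    ultimately show "factors U V b c" unfolding factors_def by blast
  qed
qed

definition quotient_bimap :: "('u \<times> 'v \<Rightarrow>\<^sub>0 int) set set \<Rightarrow> ('u, 'v) tensor_bimap" where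
  "quotient_bimap K = (T Mod K, \<lambda>u v. K #>\<^bsub>T\<^esub> pure_tensor U V u v)"

lemma full_bimap_quotient_bimap:
  assumes "subgroup K T"
  shows "full_bimap U V (quotient_bimap K)"
proof -
  have "(\<lambda>t. K #>\<^bsub>T\<^esub> t) \<in> hom (fst (T, pure_tensor U V)) (T Mod K)"
    unfolding fst_conv by (rule group_hom.homh[OF T.quotient_group_hom[OF assms]])
  moreover have "(\<lambda>t. K #>\<^bsub>T\<^esub> t) ` carrier (fst (T, pure_tensor U V)) = carrier (T Mod K)"
    by (simp only: fst_conv carrier_FactGroup)
  ultimately show ?thesis
    unfolding quotient_bimap_def
    by (rule full_bimap_quotient[OF full_bimap_tensor T.abelian_FactGroup[OF assms],
          unfolded snd_conv])
qed

text \<open>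
  By uniqueness, the linearization of \<open>quotient_bimap K\<close> is the canonical projection.
\<close>

lemma bimap_kernel_quotient_bimap:
  assumes "subgroup K T"
  shows "bimap_kernel (quotient_bimap K) = K"
proof -
  have "K #>\<^bsub>T\<^esub> t = linearization (quotient_bimap K) t" if "t \<in> carrier T" for t
    by (rule linearization_unique[OF full_bimap_quotient_bimap[OF assms] _ _ that])
      (simp_all add: quotient_bimap_def T.quotient_group_hom[OF assms])
  then show ?thesis
    using T.kernel_quotient_hom[OF assms]
    by (auto simp: bimap_kernel_def kernel_def quotient_bimap_def)
qed

lemma tensor_over_eq_quotient: "tensor_over U V S = quotient_bimap (balancing_subgroup U V S)"
  by (simp add: tensor_over_def quotient_bimap_def)

section \<open>Adjoints as balancing relations\<close>

lemma Endo_closed: "x \<in> Endo G \<Longrightarrow> g \<in> carrier G \<Longrightarrow> x g \<in> carrier G"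
  by (auto simp: Endo_def hom_def)

lemma subgroup_balancing:
  assumes "S \<subseteq> Endo U \<times> Endo V"
  shows "subgroup (balancing_subgroup U V S) T"
  unfolding balancing_subgroup_def
proof (rule T.generate_is_subgroup, clarify)
  fix x y u v assume "(x, y) \<in> S" and uv: "u \<in> carrier U" "v \<in> carrier V"
  then have "x u \<in> carrier U" "y v \<in> carrier V"
    using assms Endo_closed[of x U u] Endo_closed[of y V v] by auto
  then show "pure_tensor U V (x u) v \<otimes>\<^bsub>T\<^esub> inv\<^bsub>T\<^esub> pure_tensor U V u (y v) \<in> carrier T"
    using uv by (intro T.m_closed T.inv_closed pure_tensor_closed)
qed

lemma full_bimap_tensor_over:
  assumes "S \<subseteq> Endo U \<times> Endo V"
  shows "full_bimap U V (tensor_over U V S)"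
  unfolding tensor_over_eq_quotient by (rule full_bimap_quotient_bimap[OF subgroup_balancing[OF assms]])

text \<open>
  The kernel of \<open>b\<close> is a subgroup, so it suffices to test the generators of the balancing subgroup.
  The linearization of \<open>b\<close> sends \<open>us \<otimes> v - u \<otimes> sv\<close> to the difference of \<open>us \<circ> v\<close> and \<open>u \<circ> sv\<close>.
\<close>

lemma balancing_subset_kernel_iff:
  assumes S: "S \<subseteq> Endo U \<times> Endo V" and b: "full_bimap U V b"
  shows "balancing_subgroup U V S \<subseteq> bimap_kernel b \<longleftrightarrow> S \<subseteq> Adj U V b"
proof -
  interpret h: group_hom T "fst b" "linearization b" by (rule linearization(1)[OF b])
  let ?r = "\<lambda>x y u v. pure_tensor U V (x u) v \<otimes>\<^bsub>T\<^esub> inv\<^bsub>T\<^esub> pure_tensor U V u (y v)"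
  have ker: "?r x y u v \<in> bimap_kernel b \<longleftrightarrow> snd b (x u) v = snd b u (y v)"
    if "(x, y) \<in> S" and uv: "u \<in> carrier U" "v \<in> carrier V" for x y u v
  proof -
    have xy: "x u \<in> carrier U" "y v \<in> carrier V" using that S Endo_closed[of x U u] Endo_closed[of y V v] by auto
    note carr = pure_tensor_closed[OF xy(1) uv(2)] pure_tensor_closed[OF uv(1) xy(2)]
    note bcarr = biadditive_closed[OF full_bimapD(2)[OF b] xy(1) uv(2)]
      biadditive_closed[OF full_bimapD(2)[OF b] uv(1) xy(2)]
    have "linearization b (?r x y u v) = snd b (x u) v \<otimes>\<^bsub>fst b\<^esub> inv\<^bsub>fst b\<^esub> snd b u (y v)"
      using carr uv xy by (simp add: linearization(2)[OF b])
    moreover have "\<dots> = \<one>\<^bsub>fst b\<^esub> \<longleftrightarrow> snd b (x u) v = snd b u (y v)"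
      using bcarr by (rule h.H.mult_inv_eq_one_iff)
    ultimately show ?thesis
      using carr by (simp add: bimap_kernel_def kernel_def)
  qed
  define R where "R = {?r x y u v |x y u v. (x, y) \<in> S \<and> u \<in> carrier U \<and> v \<in> carrier V}"
  have "generate T R \<subseteq> bimap_kernel b \<longleftrightarrow> R \<subseteq> bimap_kernel b"
    using T.generate_subgroup_incl[OF _ subgroup_bimap_kernel[OF b], of R] generate.incl[of _ R T]
    by blast
  then have "balancing_subgroup U V S \<subseteq> bimap_kernel b \<longleftrightarrow> R \<subseteq> bimap_kernel b"
    by (simp only: balancing_subgroup_def R_def)
  also have "\<dots> \<longleftrightarrow> (\<forall>(x, y)\<in>S. \<forall>u\<in>carrier U. \<forall>v\<in>carrier V. ?r x y u v \<in> bimap_kernel b)"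
    unfolding R_def by fast
  also have "\<dots> \<longleftrightarrow> (\<forall>(x, y)\<in>S. \<forall>u\<in>carrier U. \<forall>v\<in>carrier V. snd b (x u) v = snd b u (y v))"
    by (intro ball_cong refl) (auto simp: ker)
  also have "\<dots> \<longleftrightarrow> S \<subseteq> Adj U V b"
    using S by (auto simp: Adj_def)
  finally show ?thesis .
qed

lemma factors_tensor_over_iff:
  assumes S: "S \<subseteq> Endo U \<times> Endo V" and b: "full_bimap U V b"
  shows "factors U V (tensor_over U V S) b \<longleftrightarrow> S \<subseteq> Adj U V b"
proof -
  have "bimap_kernel (tensor_over U V S) = balancing_subgroup U V S"
    unfolding tensor_over_eq_quotient
    by (rule bimap_kernel_quotient_bimap[OF subgroup_balancing[OF S]])
  then show ?thesis
    by (simp only: factors_iff_kernel_subset[OF full_bimap_tensor_over[OF S] b]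
        balancing_subset_kernel_iff[OF S b])
qed

lemma Adj_subset: "Adj U V b \<subseteq> Endo U \<times> Endo V"
  by (auto simp: Adj_def)

lemma subset_Adj_tensor_over:
  assumes "S \<subseteq> Endo U \<times> Endo V"
  shows "S \<subseteq> Adj U V (tensor_over U V S)"
  using factors_tensor_over_iff[OF assms full_bimap_tensor_over[OF assms]] factors_refl by blast

lemma factors_tensor_over_Adj:
  assumes "full_bimap U V b"
  shows "factors U V (tensor_over U V (Adj U V b)) b"
  using factors_tensor_over_iff[OF Adj_subset assms] by blast

text \<open>
  One inclusion is \<open>S \<subseteq> Adj(\<otimes>\<^sub>S)\<close> for \<open>S = Adj(b)\<close>; the other holds because \<open>\<otimes>\<^bsub>Adj(b)\<^esub> \<rightarrow> b\<close> and
  adjoints persist along \<open>\<rightarrow>\<close>.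
\<close>

lemma Adj_tensor_over_Adj:
  assumes "full_bimap U V b"
  shows "Adj U V (tensor_over U V (Adj U V b)) = Adj U V b"
  by (intro equalityI subset_Adj_tensor_over Adj_subset factors_Adj_mono factors_tensor_over_Adj assms)

lemma tensor_over_Adj_tensor_over:
  assumes S: "S \<subseteq> Endo U \<times> Endo V"
  shows "factor_equiv U V (tensor_over U V (Adj U V (tensor_over U V S))) (tensor_over U V S)"
proof -
  have "S \<subseteq> Adj U V (tensor_over U V (Adj U V (tensor_over U V S)))"
    using subset_Adj_tensor_over[OF S] subset_Adj_tensor_over[OF Adj_subset] by blast
  then show ?thesis
    unfolding factor_equiv_def
    by (simp add: factors_tensor_over_Adj full_bimap_tensor_over factors_tensor_over_iff S Adj_subset)
qed

section \<open>The two lattices\<close>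

lemma bimap_class_cases:
  assumes "B \<in> carrier (bimap_lattice U V)"
  obtains b where "b \<in> B" "full_bimap U V b" "B = factor_rel U V `` {b}"
proof -
  obtain b where "full_bimap U V b" "B = factor_rel U V `` {b}"
    using assms by (auto simp: bimap_lattice_def elim: quotientE)
  then show thesis
    using that equiv_class_self[OF equiv_factor_rel] by blast
qed

lemma factor_class_in_carrier:
  "full_bimap U V b \<Longrightarrow> factor_rel U V `` {b} \<in> carrier (bimap_lattice U V)"
  by (simp add: bimap_lattice_def quotientI)

lemma self_in_factor_class: "full_bimap U V b \<Longrightarrow> b \<in> factor_rel U V `` {b}"
  using equiv_class_self[OF equiv_factor_rel] by blast

lemma partial_order_bimap_lattice: "partial_order (bimap_lattice U V)"
proof
  show "(.=\<^bsub>bimap_lattice U V\<^esub>) = (=)" by (simp add: bimap_lattice_def)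
  fix A B assume A: "A \<in> carrier (bimap_lattice U V)" and B: "B \<in> carrier (bimap_lattice U V)"
  obtain a where a: "a \<in> A" "full_bimap U V a" "A = factor_rel U V `` {a}"
    using bimap_class_cases[OF A] .
  obtain b where b: "b \<in> B" "full_bimap U V b" "B = factor_rel U V `` {b}"
    using bimap_class_cases[OF B] .
  show "A \<sqsubseteq>\<^bsub>bimap_lattice U V\<^esub> A"
    using le_bimap_lattice_iff[OF A A a(1) a(1)] factors_refl by blast
  show "A .=\<^bsub>bimap_lattice U V\<^esub> B"
    if "A \<sqsubseteq>\<^bsub>bimap_lattice U V\<^esub> B" "B \<sqsubseteq>\<^bsub>bimap_lattice U V\<^esub> A"
  proof -
    have "(a, b) \<in> factor_rel U V"
      using that le_bimap_lattice_iff[OF A B a(1) b(1)] le_bimap_lattice_iff[OF B A b(1) a(1)] a b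
      by (simp add: factor_rel_def factor_equiv_def)
    then have "A = B" using equiv_class_eq[OF equiv_factor_rel] a b by blast
    then show ?thesis by (simp add: bimap_lattice_def)
  qed
  fix C assume C: "C \<in> carrier (bimap_lattice U V)"
    and "A \<sqsubseteq>\<^bsub>bimap_lattice U V\<^esub> B" "B \<sqsubseteq>\<^bsub>bimap_lattice U V\<^esub> C"
  moreover obtain c where c: "c \<in> C" using bimap_class_cases[OF C] .
  ultimately show "A \<sqsubseteq>\<^bsub>bimap_lattice U V\<^esub> C"
    using le_bimap_lattice_iff[OF A B a(1) b(1)] le_bimap_lattice_iff[OF B C b(1) c]
      le_bimap_lattice_iff[OF A C a(1) c] factors_trans by blast
qed (auto simp: bimap_lattice_def)

text \<open>
  The kernel of a representative embeds the classes into the subgroups of \<open>U \<otimes> V\<close>, reflects the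
  order, and is onto; so the lattice structure of the subgroups carries over.
\<close>

lemma lattice_bimap_lattice: "lattice (bimap_lattice U V)"
proof -
  let ?M = "\<lparr>carrier = {K. subgroup K T}, eq = (=), le = (\<subseteq>)\<rparr>"
  let ?f = "\<lambda>B. bimap_kernel (SOME b. b \<in> B)"
  interpret M: complete_lattice ?M by (rule T.subgroups_complete_lattice)
  have rep: "(SOME b. b \<in> B) \<in> B" "full_bimap U V (SOME b. b \<in> B)"
    if "B \<in> carrier (bimap_lattice U V)" for B
  proof -
    show "(SOME b. b \<in> B) \<in> B"
      using bimap_class_cases[OF that] by (metis someI)
    then show "full_bimap U V (SOME b. b \<in> B)"
      using bimap_class_cases[OF that] by (metis (no_types, lifting) Image_singleton_iff factor_rel_def mem_Collect_eq case_prodD)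
  qed
  have le: "A \<sqsubseteq>\<^bsub>bimap_lattice U V\<^esub> B \<longleftrightarrow> ?f A \<subseteq> ?f B"
    if "A \<in> carrier (bimap_lattice U V)" "B \<in> carrier (bimap_lattice U V)" for A B
    using le_bimap_lattice_iff[OF that rep(1)[OF that(1)] rep(1)[OF that(2)]]
      factors_iff_kernel_subset[OF rep(2)[OF that(1)] rep(2)[OF that(2)]] by simp
  have "K \<in> ?f ` carrier (bimap_lattice U V)" if K: "subgroup K T" for K
  proof
    let ?b = "quotient_bimap K" and ?B = "factor_rel U V `` {quotient_bimap K}"
    note b = full_bimap_quotient_bimap[OF K]
    show B: "?B \<in> carrier (bimap_lattice U V)" by (rule factor_class_in_carrier[OF b])
    have "(?b, SOME b. b \<in> ?B) \<in> factor_rel U V"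
      using rep(1)[OF B] by simp
    then have "bimap_kernel ?b = ?f ?B"
      using factors_iff_kernel_subset[OF b rep(2)[OF B]] factors_iff_kernel_subset[OF rep(2)[OF B] b]
      unfolding factor_rel_def factor_equiv_def by blast
    then show "K = ?f ?B" by (simp add: bimap_kernel_quotient_bimap[OF K])
  qed
  then have "?f ` carrier (bimap_lattice U V) = carrier ?M"
    using subgroup_bimap_kernel[OF rep(2)] by auto
  then show ?thesis
    using le by (intro lattice_order_embedding[OF partial_order_bimap_lattice M.lattice_axioms]) simp_all
qed

lemma lattice_subset_lattice: "lattice (subset_lattice U V)"
proof -
  interpret complete_lattice "subset_lattice U V"
    unfolding subset_lattice_def by (rule powerset_is_complete_lattice)
  show ?thesis by (rule lattice_axioms)
qed

lemma galois_connection_adjoint_tensor: "galois_connection (adjoint_tensor_connection U V)"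
proof -
  have tensor_class: "tensor_class U V S \<in> carrier (bimap_lattice U V)"
    "tensor_over U V S \<in> tensor_class U V S" if "S \<subseteq> Endo U \<times> Endo V" for S
    unfolding tensor_class_def
    using full_bimap_tensor_over[OF that] by (rule factor_class_in_carrier self_in_factor_class)+
  interpret subset: lattice "subset_lattice U V" by (rule lattice_subset_lattice)
  show ?thesis
  proof (intro galois_connection.intro connection.intro galois_connection_axioms.intro)
    show "partial_order (orderA (adjoint_tensor_connection U V))"
      by (simp add: adjoint_tensor_connection_def subset.partial_order_axioms)
    show "partial_order (orderB (adjoint_tensor_connection U V))"
      by (simp add: adjoint_tensor_connection_def partial_order_bimap_lattice)
    show "lower (adjoint_tensor_connection U V) \<in>
      carrier (orderA (adjoint_tensor_connection U V)) \<rightarrow> carrier (orderB (adjoint_tensor_connection U V))"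
      using tensor_class by (auto simp: adjoint_tensor_connection_def subset_lattice_def)
    show "upper (adjoint_tensor_connection U V) \<in>
      carrier (orderB (adjoint_tensor_connection U V)) \<rightarrow> carrier (orderA (adjoint_tensor_connection U V))"
    proof
      fix B assume "B \<in> carrier (orderB (adjoint_tensor_connection U V))"
      then have B: "B \<in> carrier (bimap_lattice U V)" by (simp add: adjoint_tensor_connection_def)
      obtain b where "b \<in> B" using bimap_class_cases[OF B] .
      then show "upper (adjoint_tensor_connection U V) B \<in> carrier (orderA (adjoint_tensor_connection U V))"
        using Adj_class_eq[OF B] Adj_subset
        by (simp add: adjoint_tensor_connection_def subset_lattice_def)
    qed
    fix S B
    assume "S \<in> carrier (orderA (adjoint_tensor_connection U V))"
      and "B \<in> carrier (orderB (adjoint_tensor_connection U V))"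
    then have S: "S \<subseteq> Endo U \<times> Endo V" and B: "B \<in> carrier (bimap_lattice U V)"
      by (simp_all add: adjoint_tensor_connection_def subset_lattice_def)
    obtain b where b: "b \<in> B" "full_bimap U V b" using bimap_class_cases[OF B] .
    have "tensor_class U V S \<sqsubseteq>\<^bsub>bimap_lattice U V\<^esub> B \<longleftrightarrow> S \<subseteq> Adj_class U V B"
      using le_bimap_lattice_iff[OF tensor_class(1)[OF S] B tensor_class(2)[OF S] b(1)]
        factors_tensor_over_iff[OF S b(2)] Adj_class_eq[OF B b(1)] by simp
    then show "lower (adjoint_tensor_connection U V) S \<sqsubseteq>\<^bsub>orderB (adjoint_tensor_connection U V)\<^esub> B
      \<longleftrightarrow> S \<sqsubseteq>\<^bsub>orderA (adjoint_tensor_connection U V)\<^esub> upper (adjoint_tensor_connection U V) B"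
      by (simp add: adjoint_tensor_connection_def subset_lattice_def)
  qed
qed

end

section \<open>Closure operators of a Galois connection\<close>

text \<open>
  \<open>\<pi>\<^sub>* (\<pi>\<^sup>* x)\<close> lies above \<open>x\<close> but \<open>\<pi>\<^sup>* (\<pi>\<^sub>* y)\<close> lies below \<open>y\<close>, so the latter is extensive only after
  the order of its domain is reversed.
\<close>

lemma closure_operators_galois:
  fixes G :: "('a, 'b) galois" (structure)
  assumes "galois_connection G"
  shows "closure_operator \<X> (\<lambda>x. \<pi>\<^sub>* (\<pi>\<^sup>* x))"
    "closure_operator (inv_gorder \<Y>) (\<lambda>y. \<pi>\<^sup>* (\<pi>\<^sub>* y))"
proof -
  interpret galois_connection G by fact
  interpret Y: partial_order \<Y> by (rule is_order_B)
  show "closure_operator \<X> (\<lambda>x. \<pi>\<^sub>* (\<pi>\<^sup>* x))"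
    using gf_iso adjoint_idem2 inflation lower_closed upper_closed
    by (auto simp: closure_operator_def comp_def)
  show "closure_operator (inv_gorder \<Y>) (\<lambda>y. \<pi>\<^sup>* (\<pi>\<^sub>* y))"
    using fg_iso adjoint_idem1 deflation lower_closed upper_closed
    by (auto simp: closure_operator_def comp_def idempotent_def)
qed

theorem theorem2p11:
  fixes U :: "'u monoid" and V :: "'v monoid" and W :: "'w monoid"
    and circ :: "'u \<Rightarrow> 'v \<Rightarrow> 'w"
    and S :: "(('u \<Rightarrow> 'u) \<times> ('v \<Rightarrow> 'v)) set"
  assumes "comm_group U" and "comm_group V"
    and "S \<subseteq> Endo U \<times> Endo V"
    and "full_bimap U V (W, circ)"
  shows "(factors U V (tensor_over U V S) (W, circ) \<longleftrightarrow> S \<subseteq> Adj U V (W, circ)) \<and>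
    lattice (bimap_lattice U V) \<and>
    lattice (subset_lattice U V) \<and>
    galois_connection (adjoint_tensor_connection U V) \<and>
    Adj U V (tensor_over U V (Adj U V (W, circ))) = Adj U V (W, circ) \<and>
    factor_equiv U V (tensor_over U V (Adj U V (tensor_over U V S))) (tensor_over U V S) \<and>
    closure_operator (subset_lattice U V) (\<lambda>T. Adj_class U V (tensor_class U V T)) \<and>
    closure_operator (inv_gorder (bimap_lattice U V)) (\<lambda>B. tensor_class U V (Adj_class U V B))"
proof -
  interpret abelian_pair U V using assms(1,2) by (rule abelian_pair.intro)
  note gc = galois_connection_adjoint_tensor
  show ?thesis
    using closure_operators_galois[OF gc, unfolded adjoint_tensor_connection_def galcon.simps]
    by (intro conjI factors_tensor_over_iff lattice_bimap_lattice lattice_subset_lattice gc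
        Adj_tensor_over_Adj tensor_over_Adj_tensor_over assms(3,4))
qed

end
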